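(* Let $p:\mathbb{R}^n\to(0,\infty)$ be measurable with $0<p^-\le p^+<\infty$. For every $\theta\in(0,1)$, $$\big(L^{(1-\theta)p(\cdot)}(\mathbb{R}^n),L^\infty(\mathbb{R}^n)\big)_{\theta,\infty}=w\text{-}L^{p(\cdot)}(\mathbb{R}^n),$$ as sets and with equivalent quasinorms.
   Context: $p^-:=\operatorname{ess\,inf}p$, $p^+:=\operatorname{ess\,sup}p$. $L^{s(\cdot)}(\mathbb{R}^n)$: measurable $f$ with $\int|f(x)|^{s(x)}dx<\infty$, with Luxemburg (quasi-)norm $\|f\|_{s(\cdot)}:=\inf\{\lambda>0:\int|f/\lambda|^{s(x)}dx\le1\}$. Weak space $w\text{-}L^{s(\cdot)}(\mathbb{R}^n)$: measurable $f$ with $\|f\|_{w\text{-}L^{s(\cdot)}}:=\sup_{\lambda>0}\lambda\|\chi_{\{|f|>\lambda\}}\|_{s(\cdot)}<\infty$. Real interpolation: for compatible quasi-normed spaces $A_0,A_1$ and $a\in A_0+A_1$, the Peetre $K$-functional is $K(t,a):=\inf\{\|a_0\|_{A_0}+t\|a_1\|_{A_1}: a_0+a_1=a,\ a_0\in A_0,\ a_1\in A_1\}$, $t>0$; $(A_0,A_1)_{\theta,\infty}$ is the set of $a\in A_0+A_1$ with $\|a\|_{(A_0,A_1)_{\theta,\infty}}:=\sup_{t>0}t^{-\theta}K(t,a)<\infty$. *)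

theory Defs
  imports
    "HOL-Analysis.Analysis"
    "HOL-Probability.Essential_Supremum"
    "HOL-Library.Function_Algebras"
begin

text \<open>
  Function spaces are sets of everywhere defined functions, not of classes modulo null sets. All
  spaces and functionals below are invariant under changes on null sets, so passing to classes
  changes neither the sets nor the values of the quasinorms or of the \<open>K\<close>-functional.
  Quasinorms take values in \<^typ>\<open>ennreal\<close>, and \<open>Inf {} = \<infinity>\<close>.
\<close>

definition essinf :: "'a measure \<Rightarrow> ('a \<Rightarrow> 'b::complete_lattice) \<Rightarrow> 'b" where
  "essinf M f = Sup {z. AE x in M. z \<le> f x}"


section \<open>Variable exponent Lebesgue spaces\<close>

definition modular :: "(real^'n \<Rightarrow> real) \<Rightarrow> (real^'n \<Rightarrow> 'b::real_normed_vector) \<Rightarrow> ennreal" where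
  "modular s f = (\<integral>\<^sup>+ x. ennreal (norm (f x) powr s x) \<partial>lebesgue)"

definition Lvar :: "(real^'n \<Rightarrow> real) \<Rightarrow> (real^'n \<Rightarrow> 'b::real_normed_vector) set" where
  "Lvar s = {f. f \<in> borel_measurable lebesgue \<and> modular s f < \<infinity>}"

definition Lvar_norm :: "(real^'n \<Rightarrow> real) \<Rightarrow> (real^'n \<Rightarrow> 'b::real_normed_vector) \<Rightarrow> ennreal" where
  "Lvar_norm s f = Inf {ennreal l | l. l > 0 \<and> modular s (\<lambda>x. f x /\<^sub>R l) \<le> 1}"

definition wLvar_norm :: "(real^'n \<Rightarrow> real) \<Rightarrow> (real^'n \<Rightarrow> 'b::real_normed_vector) \<Rightarrow> ennreal" where
  "wLvar_norm s f =
     (SUP l\<in>{0<..}. ennreal l * Lvar_norm s (indicator {x. norm (f x) > l} :: real^'n \<Rightarrow> real))"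

definition wLvar :: "(real^'n \<Rightarrow> real) \<Rightarrow> (real^'n \<Rightarrow> 'b::real_normed_vector) set" where
  "wLvar s = {f. f \<in> borel_measurable lebesgue \<and> wLvar_norm s f < \<infinity>}"

definition Linf_norm :: "(real^'n \<Rightarrow> 'b::real_normed_vector) \<Rightarrow> ennreal" where
  "Linf_norm f = esssup lebesgue (\<lambda>x. ennreal (norm (f x)))"

definition Linf :: "(real^'n \<Rightarrow> 'b::real_normed_vector) set" where
  "Linf = {f. f \<in> borel_measurable lebesgue \<and> Linf_norm f < \<infinity>}"


section \<open>Real interpolation with second parameter infinity\<close>

text \<open>
  A compatible couple is given by carriers \<open>A0\<close>, \<open>A1\<close> in a common ambient vector space (for
  function spaces: all functions, with the pointwise sum) and quasinorms \<open>N0\<close>, \<open>N1\<close> on them.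
\<close>

definition peetre_K ::
  "'v::ab_group_add set \<Rightarrow> ('v \<Rightarrow> ennreal) \<Rightarrow> 'v set \<Rightarrow> ('v \<Rightarrow> ennreal) \<Rightarrow> real \<Rightarrow> 'v \<Rightarrow> ennreal" where
  "peetre_K A0 N0 A1 N1 t a =
     Inf {N0 a0 + ennreal t * N1 a1 | a0 a1. a0 + a1 = a \<and> a0 \<in> A0 \<and> a1 \<in> A1}"

definition interp_norm ::
  "'v::ab_group_add set \<Rightarrow> ('v \<Rightarrow> ennreal) \<Rightarrow> 'v set \<Rightarrow> ('v \<Rightarrow> ennreal) \<Rightarrow> real \<Rightarrow> 'v \<Rightarrow> ennreal" where
  "interp_norm A0 N0 A1 N1 \<theta> a =
     (SUP t\<in>{0<..}. ennreal (t powr (- \<theta>)) * peetre_K A0 N0 A1 N1 t a)"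

definition interp_space ::
  "'v::ab_group_add set \<Rightarrow> ('v \<Rightarrow> ennreal) \<Rightarrow> 'v set \<Rightarrow> ('v \<Rightarrow> ennreal) \<Rightarrow> real \<Rightarrow> 'v set" where
  "interp_space A0 N0 A1 N1 \<theta> =
     {a. (\<exists>a0\<in>A0. \<exists>a1\<in>A1. a = a0 + a1) \<and> interp_norm A0 N0 A1 N1 \<theta> a < \<infinity>}"

definition equivalent_on :: "'v set \<Rightarrow> ('v \<Rightarrow> ennreal) \<Rightarrow> ('v \<Rightarrow> ennreal) \<Rightarrow> bool" where
  "equivalent_on A N N' \<longleftrightarrow>
     (\<exists>c C :: real. c > 0 \<and> C > 0 \<and>
        (\<forall>a\<in>A. ennreal c * N a \<le> N' a \<and> N' a \<le> ennreal C * N a))"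

end

theory Submission
  imports Defs
begin

text \<open>
  Truncating \<open>f\<close> at a height \<open>a\<close> splits it into a large part, to be put into the variable exponent
  space with exponent \<open>q = (1 - \<theta>) p\<close>, and a part bounded by \<open>a\<close>. The height that suits the
  parameter \<open>t\<close> of the \<open>K\<close>-functional is proportional to \<open>t powr (\<theta> - 1)\<close>, since \<open>t\<close> times the
  bounded part then has size \<open>t powr \<theta>\<close>. The bound \<open>wLvar_norm p f \<le> B\<close> is handled in the form
  \<open>\<integral>\<^bsub>{|f| > l}\<^esub> (l / B) powr p \<le> 1\<close> for every \<open>l > 0\<close>, which avoids taking infima.

  \<^item> If \<open>K(t, f) < A t powr \<theta>\<close>, choose \<open>t\<close> with \<open>t powr (1 - \<theta>) = 2 A / l\<close>. A nearly optimal
    decomposition \<open>f = f0 + f1\<close> then has \<open>|f1| \<le> l / 2\<close> almost everywhere, so \<open>|f0| \<ge> l / 2\<close>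
    wherever \<open>|f| > l\<close>, up to a null set, and the modular of \<open>f0 / (A t powr \<theta>)\<close> with exponent
    \<open>q\<close> dominates the integral of \<open>(1 / t) powr q = (l / (2 A)) powr p\<close> over \<open>{|f| > l}\<close>. This gives
    \<open>wLvar_norm p f \<le> 2 interp_norm f\<close> (lemma \<open>wLvar_norm_le_interp_norm\<close>).

  \<^item> Conversely let \<open>wLvar_norm p f < B\<close> and truncate at \<open>a = B t powr (\<theta> - 1)\<close>. On the layer
    where \<open>|f|\<close> lies between \<open>2 ^ k a\<close> and \<open>2 ^ (k + 1) a\<close>, the integrand
    \<open>(|f| / (2 D B t powr \<theta>)) powr q\<close> is at most
    \<open>(2 ^ k a / B) powr p\<close> times the small factor \<open>D powr (- q) 2 powr (- k \<theta> p)\<close>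
    (lemma \<open>dyadic_layer_bound\<close>). The factor comes from the gap between the exponents \<open>q\<close> and \<open>p\<close>;
    as \<open>p\<close> is bounded below by some \<open>m > 0\<close>, it decays geometrically in \<open>k\<close>, uniformly in the
    point. Integrating and summing over \<open>k\<close> bounds the modular of the large part by a geometric
    series, which equals \<open>1\<close> for a suitable constant \<open>D\<close> depending only on \<open>\<theta>\<close> and \<open>m\<close>. Hence
    \<open>K(t, f) \<le> (2 D + 1) B t powr \<theta>\<close> (lemma \<open>interp_norm_le_wLvar_norm\<close>).

  The upper bound of \<open>p\<close> ensures that a function with finite modular after scaling has finite
  modular itself, so that the large part belongs to the space (lemma \<open>Lvar_of_modular_scaled\<close>).
\<close>


section \<open>Strong and weak norms in terms of modulars\<close>

lemma Lvar_norm_leI: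
  assumes "l > 0" "modular s (\<lambda>x. f x /\<^sub>R l) \<le> 1"
  shows "Lvar_norm s f \<le> ennreal l"
  unfolding Lvar_norm_def using assms by (auto intro!: Inf_lower)

lemma modular_le_one_of_Lvar_norm_less:
  assumes s: "\<And>x. s x \<ge> 0" and less: "Lvar_norm s f < ennreal B"
  shows "modular s (\<lambda>x. f x /\<^sub>R B) \<le> 1"
proof -
  obtain l where l: "l > 0" "modular s (\<lambda>x. f x /\<^sub>R l) \<le> 1" "ennreal l < ennreal B"
    using less unfolding Lvar_norm_def Inf_less_iff by blast
  then have "l < B" using ennreal_lessI ennreal_less_iff by fastforce
  have "norm (f x /\<^sub>R B) powr s x \<le> norm (f x /\<^sub>R l) powr s x" for x
    using l(1) \<open>l < B\<close> s by (intro powr_mono2) (auto simp: divide_simps mult_left_mono)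
  then have "modular s (\<lambda>x. f x /\<^sub>R B) \<le> modular s (\<lambda>x. f x /\<^sub>R l)"
    unfolding modular_def by (intro nn_integral_mono ennreal_leI)
  then show ?thesis using l(2) by order
qed

lemma modular_indicator:
  assumes "c > 0"
  shows "modular s (\<lambda>x. (indicator E x :: real) /\<^sub>R c)
       = (\<integral>\<^sup>+ x. ennreal (indicator E x * (1 / c) powr s x) \<partial>lebesgue)"
  unfolding modular_def using assms
  by (intro nn_integral_cong) (auto simp: indicator_def divide_simps)

text \<open>
  The modular with exponent \<open>s\<close> of the indicator of \<open>{|f| > l}\<close> divided by \<open>B / l\<close>; it is at most
  \<open>1\<close> for every \<open>l\<close> when \<open>B\<close> bounds the weak norm of \<open>f\<close> strictly.
\<close>

definition weak_modular ::
  "(real^'n \<Rightarrow> real) \<Rightarrow> (real^'n \<Rightarrow> 'b::real_normed_vector) \<Rightarrow> real \<Rightarrow> real \<Rightarrow> ennreal" where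
  "weak_modular s f B l =
     (\<integral>\<^sup>+ x. ennreal (indicator {x. norm (f x) > l} x * (l / B) powr s x) \<partial>lebesgue)"

lemma wLvar_norm_leI:
  assumes "B > 0" and "\<And>l. l > 0 \<Longrightarrow> weak_modular s f B l \<le> 1"
  shows "wLvar_norm s f \<le> ennreal B"
  unfolding wLvar_norm_def
proof (rule SUP_least)
  fix l :: real assume "l \<in> {0<..}"
  then have l: "l > 0" by simp
  have "Lvar_norm s (indicat_real {x. norm (f x) > l}) \<le> ennreal (B / l)"
    using assms(1) assms(2)[OF l] l modular_indicator[of "B / l" s "{x. norm (f x) > l}"]
    by (intro Lvar_norm_leI) (simp_all add: weak_modular_def)
  then have "ennreal l * Lvar_norm s (indicat_real {x. norm (f x) > l})
      \<le> ennreal l * ennreal (B / l)" by (rule mult_left_mono) simp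
  also have "\<dots> = ennreal B" using l assms(1) by (simp add: ennreal_mult'[symmetric])
  finally show "ennreal l * Lvar_norm s (indicat_real {x. norm (f x) > l})
      \<le> ennreal B" .
qed

lemma weak_modular_le_one_of_wLvar_norm_less:
  assumes s: "\<And>x. s x \<ge> 0" and less: "wLvar_norm s f < ennreal B" and "B > 0" "l > 0"
  shows "weak_modular s f B l \<le> 1"
proof -
  let ?N = "Lvar_norm s (indicat_real {x. norm (f x) > l})"
  have "ennreal l * ?N \<le> wLvar_norm s f"
    unfolding wLvar_norm_def using \<open>l > 0\<close> by (intro SUP_upper) auto
  then have *: "ennreal l * ?N < ennreal B" using less by order
  have "?N < ennreal (B / l)"
  proof (rule ccontr)
    assume "\<not> ?N < ennreal (B / l)"
    then have "ennreal l * ennreal (B / l) \<le> ennreal l * ?N" by (intro mult_left_mono) auto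
    moreover have "ennreal l * ennreal (B / l) = ennreal B"
      using assms by (simp add: ennreal_mult'[symmetric])
    ultimately show False using * by simp
  qed
  then have "modular s (\<lambda>x. (indicator {x. norm (f x) > l} x :: real) /\<^sub>R (B / l)) \<le> 1"
    by (intro modular_le_one_of_Lvar_norm_less s)
  then show ?thesis using assms modular_indicator[of "B / l" s "{x. norm (f x) > l}"]
    by (simp add: weak_modular_def)
qed

text \<open>
  Reduces an inequality between quasinorms to strict real bounds \<open>B\<close> of the right-hand side, which
  are positive. Infinite and vanishing norms then need no separate treatment.
\<close>

lemma ennreal_le_cmult_of_less:
  fixes a b :: ennreal
  assumes "c > 0" and "\<And>B. B > 0 \<Longrightarrow> b < ennreal B \<Longrightarrow> a \<le> ennreal (c * B)"
  shows "a \<le> ennreal c * b"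
proof (cases b)
  case top
  then show ?thesis using assms(1) by (simp add: ennreal_mult_top)
next
  case (real r)
  have "a \<le> ennreal (c * r) + ennreal e" if "e > 0" for e
  proof -
    have "a \<le> ennreal (c * (r + e / c))"
    proof (rule assms(2))
      show "r + e / c > 0" using assms(1) real that by (intro add_nonneg_pos) auto
      show "b < ennreal (r + e / c)" unfolding real(2) using assms(1) that real(1) by (intro ennreal_lessI) (auto intro: add_nonneg_pos)
    qed
    also have "c * (r + e / c) = c * r + e" using assms(1) by (simp add: distrib_left)
    also have "ennreal (c * r + e) = ennreal (c * r) + ennreal e"
      using assms(1) real that by (intro ennreal_plus) auto
    finally show ?thesis .
  qed
  then have "a \<le> ennreal (c * r)" by (rule ennreal_le_epsilon)
  also have "\<dots> = ennreal c * b" unfolding real(2) using assms(1) by (intro ennreal_mult') simp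
  finally show ?thesis .
qed

lemma AE_norm_le_of_Linf_norm_less:
  assumes "f \<in> borel_measurable lebesgue" "Linf_norm f < ennreal c"
  shows "AE x in lebesgue. norm (f x) \<le> c"
proof -
  have "AE x in lebesgue. ennreal (norm (f x)) \<le> Linf_norm f"
    unfolding Linf_norm_def by (rule esssup_AE)
  then show ?thesis
  proof eventually_elim
    case (elim x)
    then have "ennreal (norm (f x)) < ennreal c" using assms(2) by order
    then show ?case by (simp add: ennreal_less_iff)
  qed
qed

lemma Linf_norm_leI:
  assumes "f \<in> borel_measurable lebesgue" "\<And>x. norm (f x) \<le> c"
  shows "Linf_norm f \<le> ennreal c"
  unfolding Linf_norm_def using assms
  by (intro esssup_I) (auto intro: ennreal_leI)


section \<open>The weak norm is bounded by the interpolation norm\<close>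

lemma wLvar_norm_le_interp_norm:
  fixes f :: "real^'n \<Rightarrow> 'b::{real_normed_field, second_countable_topology}"
  assumes p: "\<And>x. p x > 0" and \<theta>: "0 < \<theta>" "\<theta> < 1"
  shows "wLvar_norm p f \<le> ennreal 2 *
    interp_norm (Lvar (\<lambda>x. (1 - \<theta>) * p x)) (Lvar_norm (\<lambda>x. (1 - \<theta>) * p x)) Linf Linf_norm \<theta> f"
proof (rule ennreal_le_cmult_of_less)
  let ?q = "\<lambda>x. (1 - \<theta>) * p x"
  fix A :: real
  assume A: "A > 0" and less: "interp_norm (Lvar ?q) (Lvar_norm ?q) Linf Linf_norm \<theta> f < ennreal A"
  show "wLvar_norm p f \<le> ennreal (2 * A)"
  proof (rule wLvar_norm_leI)
    fix l :: real assume l: "l > 0"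
    \<comment> \<open>This \<open>t\<close> makes \<open>A t powr \<theta> / t\<close>, the bound for \<open>f1\<close> below, equal to \<open>l / 2\<close>.\<close>
    define t where "t = (2 * A / l) powr (1 / (1 - \<theta>))"
    have t: "t > 0" using A l by (simp add: t_def)
    have t1: "t powr (1 - \<theta>) = 2 * A / l" using A l \<theta> by (simp add: t_def powr_powr)
    have t2: "t = t powr \<theta> * (2 * A / l)"
      using t by (simp add: t1[symmetric] powr_add[symmetric])
    let ?K = "peetre_K (Lvar ?q) (Lvar_norm ?q) Linf Linf_norm t f"
    have "ennreal (t powr (- \<theta>)) * ?K \<le> interp_norm (Lvar ?q) (Lvar_norm ?q) Linf Linf_norm \<theta> f"
      unfolding interp_norm_def using t by (intro SUP_upper) auto
    then have Kt: "ennreal (t powr (- \<theta>)) * ?K < ennreal A" using less by order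
    have "?K < ennreal (A * t powr \<theta>)"
    proof (rule ccontr)
      assume "\<not> ?thesis"
      then have "ennreal (t powr (- \<theta>)) * ennreal (A * t powr \<theta>) \<le> ennreal (t powr (- \<theta>)) * ?K"
        by (intro mult_left_mono) auto
      moreover have "ennreal (t powr (- \<theta>)) * ennreal (A * t powr \<theta>) = ennreal A"
        using A t by (simp add: ennreal_mult'[symmetric] powr_minus)
      ultimately show False using Kt by simp
    qed
    then obtain f0 f1 where f: "f0 + f1 = f" "f0 \<in> Lvar ?q" "f1 \<in> Linf"
      and sum: "Lvar_norm ?q f0 + ennreal t * Linf_norm f1 < ennreal (A * t powr \<theta>)"
      unfolding peetre_K_def Inf_less_iff by blast
    have "Lvar_norm ?q f0 \<le> Lvar_norm ?q f0 + ennreal t * Linf_norm f1" by simp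
    then have "Lvar_norm ?q f0 < ennreal (A * t powr \<theta>)" using sum by order
    then have mod: "modular ?q (\<lambda>x. f0 x /\<^sub>R (A * t powr \<theta>)) \<le> 1"
      using p \<theta> by (intro modular_le_one_of_Lvar_norm_less) (auto simp: less_imp_le)
    have "ennreal t * Linf_norm f1 \<le> Lvar_norm ?q f0 + ennreal t * Linf_norm f1" by simp
    then have *: "ennreal t * Linf_norm f1 < ennreal (A * t powr \<theta>)" using sum by order
    have "Linf_norm f1 < ennreal (l / 2)"
    proof (rule ccontr)
      assume "\<not> ?thesis"
      then have "ennreal t * ennreal (l / 2) \<le> ennreal t * Linf_norm f1"
        by (intro mult_left_mono) auto
      moreover have "t * (l / 2) = A * t powr \<theta>"
        by (subst t2) (use l in simp)
      then have "ennreal t * ennreal (l / 2) = ennreal (A * t powr \<theta>)"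
        using t l by (simp add: ennreal_mult'[symmetric])
      ultimately show False using * by simp
    qed
    then have small: "AE x in lebesgue. norm (f1 x) \<le> l / 2"
      using f(3) by (intro AE_norm_le_of_Linf_norm_less) (auto simp: Linf_def)
    have c: "A * t powr \<theta> > 0" using A t by simp
    have "weak_modular p f (2 * A) l \<le> modular ?q (\<lambda>x. f0 x /\<^sub>R (A * t powr \<theta>))"
      unfolding weak_modular_def modular_def
    proof (rule nn_integral_mono_AE, use small in eventually_elim)
      case (elim x)
      show ?case
      proof (cases "norm (f x) > l")
        case True
        have "norm (f x) \<le> norm (f0 x) + norm (f1 x)"
          unfolding f(1)[symmetric] plus_fun_apply by (rule norm_triangle_ineq)
        then have "l / 2 \<le> norm (f0 x)" using elim True by linarith
        then have "(l / 2) / (A * t powr \<theta>) \<le> norm (f0 x) / (A * t powr \<theta>)"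
          using A t by (intro divide_right_mono) auto
        moreover have "(l / 2) / (A * t powr \<theta>) = 1 / t"
          by (subst (2) t2) (use A t l in \<open>simp add: divide_simps\<close>)
        ultimately have "(1 / t) powr ?q x \<le> (norm (f0 x) / (A * t powr \<theta>)) powr ?q x"
          using t p[of x] \<theta> by (intro powr_mono2) auto
        moreover have "(l / (2 * A)) powr p x = (1 / t) powr ?q x"
        proof -
          have "l / (2 * A) = 1 / (t powr (1 - \<theta>))" using t1 by simp
          also have "\<dots> = (1 / t) powr (1 - \<theta>)" using t by (simp add: powr_divide)
          finally show ?thesis by (simp add: powr_powr)
        qed
        moreover have "norm (f0 x /\<^sub>R (A * t powr \<theta>)) = norm (f0 x) / (A * t powr \<theta>)"
          unfolding norm_scaleR abs_inverse using c
          by (simp only: abs_of_pos divide_inverse mult.commute)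
        ultimately show ?thesis using True by (intro ennreal_leI) simp
      qed simp
    qed
    then show "weak_modular p f (2 * A) l \<le> 1" using mod by order
  qed (use A in simp)
qed simp


section \<open>The interpolation norm is bounded by the weak norm\<close>

lemma dyadic_level:
  fixes a y :: real
  assumes "0 < a" "a < y"
  obtains k :: nat where "2 ^ k * a < y" "y \<le> 2 ^ Suc k * a"
proof -
  obtain n :: nat where "y / a < 2 ^ n" using real_arch_pow[of 2 "y / a"] by auto
  then have n: "y \<le> 2 ^ n * a" using assms by (simp add: divide_simps mult.commute split: if_splits)
  define N where "N = (LEAST n. y \<le> 2 ^ n * a)"
  have N: "y \<le> 2 ^ N * a" unfolding N_def using n by (rule LeastI)
  then have "N \<noteq> 0" using assms by (cases N) auto
  then obtain k where k: "N = Suc k" by (cases N) auto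
  then have "\<not> y \<le> 2 ^ k * a" using not_less_Least[of k "\<lambda>n. y \<le> 2 ^ n * a"] by (auto simp: N_def)
  then show ?thesis using that[of k] N k by simp
qed

text \<open>
  The left-hand base is at most \<open>2 ^ k / (D t)\<close>, and both sides carry the same power
  \<open>t powr (- ((1 - \<theta>) p))\<close>. The powers of \<open>2 ^ k\<close> differ by \<open>\<theta> p\<close>, which is at least \<open>\<theta> m\<close>: this is
  the geometric decay that makes the layers summable.
\<close>

lemma dyadic_layer_bound:
  fixes p m \<theta> B D t y :: real
  assumes \<theta>: "0 < \<theta>" "\<theta> < 1" and "0 < m" "m \<le> p" "B > 0" "t > 0" "D \<ge> 1" "y \<ge> 0"
    and y: "y \<le> 2 ^ Suc k * (B * t powr (\<theta> - 1))"
  shows "(y / (2 * D * B * t powr \<theta>)) powr ((1 - \<theta>) * p)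
       \<le> D powr (- ((1 - \<theta>) * m)) * (2 powr (- \<theta> * m)) ^ k
           * (2 ^ k * (B * t powr (\<theta> - 1)) / B) powr p"
proof -
  have exponent: "- ((1 - \<theta>) * p) = (\<theta> - 1) * p" by (simp add: algebra_simps)
  have "y / (2 * D * B * t powr \<theta>) \<le> 2 ^ Suc k * (B * t powr (\<theta> - 1)) / (2 * D * B * t powr \<theta>)"
    using y assms by (intro divide_right_mono) auto
  also have "\<dots> = 2 powr k * t powr (-1) * D powr (-1)"
    using assms by (simp add: powr_diff powr_minus powr_realpow divide_simps)
  finally have "(y / (2 * D * B * t powr \<theta>)) powr ((1 - \<theta>) * p)
      \<le> (2 powr k * t powr (-1) * D powr (-1)) powr ((1 - \<theta>) * p)"
    using assms by (intro powr_mono2) auto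
  also have "\<dots> = 2 powr (k * ((1 - \<theta>) * p)) * t powr (- ((1 - \<theta>) * p)) * D powr (- ((1 - \<theta>) * p))"
    using assms by (simp only: powr_mult powr_powr) simp
  also have "\<dots> \<le> 2 powr (- \<theta> * m * k + k * p) * t powr (- ((1 - \<theta>) * p)) * D powr (- ((1 - \<theta>) * m))"
  proof (intro mult_mono order_refl)
    have "k * (\<theta> * m) \<le> k * (\<theta> * p)" using assms by (intro mult_left_mono) auto
    then have "k * ((1 - \<theta>) * p) \<le> - \<theta> * m * k + k * p" by (simp add: algebra_simps)
    then show "2 powr (k * ((1 - \<theta>) * p)) \<le> 2 powr (- \<theta> * m * k + k * p)" by simp
    show "D powr (- ((1 - \<theta>) * p)) \<le> D powr (- ((1 - \<theta>) * m))"
      using assms by (intro powr_mono) auto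
  qed (use assms in auto)
  also have "\<dots> = D powr (- ((1 - \<theta>) * m)) * (2 powr (- \<theta> * m)) ^ k * (2 powr k * t powr (\<theta> - 1)) powr p"
    unfolding powr_add exponent using assms
    by (simp add: powr_mult powr_powr powr_realpow[symmetric] mult_ac)
  finally show ?thesis using assms by (simp add: powr_realpow)
qed

text \<open>
  With \<open>r = 2 powr (- \<theta> m)\<close>, the layer \<open>k\<close> contributes at most \<open>(1 - r) r ^ k\<close>, and these numbers
  sum to \<open>1\<close>: the condition on \<open>D\<close> is exactly what normalizes the geometric series.
\<close>

lemma modular_truncation_le_one:
  fixes f :: "real^'n \<Rightarrow> 'b::{real_normed_field, second_countable_topology}"
  assumes p[measurable]: "p \<in> borel_measurable lebesgue" and f[measurable]: "f \<in> borel_measurable lebesgue"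
    and m: "0 < m" "AE x in lebesgue. m \<le> p x"
    and \<theta>: "0 < \<theta>" "\<theta> < 1" and "B > 0" "t > 0"
    and D: "D \<ge> 1" "D powr (- ((1 - \<theta>) * m)) = 1 - 2 powr (- \<theta> * m)"
    and weak: "\<And>l. l > 0 \<Longrightarrow> weak_modular p f B l \<le> 1"
  shows "modular (\<lambda>x. (1 - \<theta>) * p x)
    (\<lambda>x. (if norm (f x) > B * t powr (\<theta> - 1) then f x else 0) /\<^sub>R (2 * D * B * t powr \<theta>)) \<le> 1"
proof -
  define r where "r = 2 powr (- \<theta> * m)"
  have "2 powr (- \<theta> * m) < 2 powr 0" using \<theta> m by (intro powr_less_mono) auto
  then have r: "0 < r" "r < 1" by (auto simp: r_def)
  define a where "a = B * t powr (\<theta> - 1)"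
  have a: "a > 0" using assms by (simp add: a_def)
  have c: "2 * D * B * t powr \<theta> > 0" using assms by simp
  define g where "g k x = ennreal (indicator {x. norm (f x) > 2 ^ k * a} x * (2 ^ k * a / B) powr p x)" for k x
  have [measurable]: "g k \<in> borel_measurable lebesgue" for k
    unfolding g_def by measurable
  have "modular (\<lambda>x. (1 - \<theta>) * p x) (\<lambda>x. (if norm (f x) > a then f x else 0) /\<^sub>R (2 * D * B * t powr \<theta>))
      \<le> (\<integral>\<^sup>+ x. (\<Sum>k. ennreal ((1 - r) * r ^ k) * g k x) \<partial>lebesgue)"
    unfolding modular_def
  proof (rule nn_integral_mono_AE, use m(2) in eventually_elim)
    case (elim x)
    show ?case
    proof (cases "norm (f x) > a")
      case True
      then obtain k where k: "2 ^ k * a < norm (f x)" "norm (f x) \<le> 2 ^ Suc k * a"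
        using dyadic_level a by blast
      have norm_eq: "norm ((if norm (f x) > a then f x else 0) /\<^sub>R (2 * D * B * t powr \<theta>))
          = norm (f x) / (2 * D * B * t powr \<theta>)"
        unfolding norm_scaleR abs_inverse using True c
        by (simp only: abs_of_pos if_True divide_inverse mult.commute)
      have "(norm (f x) / (2 * D * B * t powr \<theta>)) powr ((1 - \<theta>) * p x)
          \<le> (1 - r) * r ^ k * (2 ^ k * a / B) powr p x"
        unfolding a_def r_def D(2)[symmetric] using assms elim k(2)
        by (intro dyadic_layer_bound) (auto simp: a_def)
      then have "ennreal ((norm (f x) / (2 * D * B * t powr \<theta>)) powr ((1 - \<theta>) * p x))
          \<le> ennreal ((1 - r) * r ^ k * (2 ^ k * a / B) powr p x)" by (rule ennreal_leI)
      also have "\<dots> = ennreal ((1 - r) * r ^ k) * g k x"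
        unfolding g_def using k(1) r by (subst ennreal_mult'[symmetric]) auto
      also have "\<dots> \<le> (\<Sum>k. ennreal ((1 - r) * r ^ k) * g k x)"
        using sum_le_suminf[of "\<lambda>k. ennreal ((1 - r) * r ^ k) * g k x" "{k}"] by simp
      finally show ?thesis unfolding norm_eq .
    qed simp
  qed
  also have "\<dots> = (\<Sum>k. ennreal ((1 - r) * r ^ k) * integral\<^sup>N lebesgue (g k))"
    by (simp add: nn_integral_suminf nn_integral_cmult)
  also have "\<dots> \<le> (\<Sum>k. ennreal ((1 - r) * r ^ k))"
  proof (intro suminf_le)
    fix k
    have "integral\<^sup>N lebesgue (g k) \<le> 1"
      using weak[of "2 ^ k * a"] a by (simp add: weak_modular_def g_def[abs_def])
    then show "ennreal ((1 - r) * r ^ k) * integral\<^sup>N lebesgue (g k) \<le> ennreal ((1 - r) * r ^ k)"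
      using mult_left_mono[of "integral\<^sup>N lebesgue (g k)" 1] by fastforce
  qed auto
  also have "\<dots> = 1"
  proof (rule sums_unique[symmetric])
    have "(\<lambda>k. (1 - r) * r ^ k) sums ((1 - r) * (1 / (1 - r)))"
      using r by (intro sums_mult geometric_sums) auto
    then show "(\<lambda>k. ennreal ((1 - r) * r ^ k)) sums 1"
      using r by (subst ennreal_1[symmetric], subst sums_ennreal) auto
  qed
  finally show ?thesis by (simp add: a_def)
qed

text \<open>
  Undoing the scaling costs the factor \<open>c powr s\<close>, which is bounded because \<open>s\<close> is.
\<close>

lemma Lvar_of_modular_scaled:
  assumes f: "f \<in> borel_measurable lebesgue"
    and s: "AE x in lebesgue. 0 \<le> s x \<and> s x \<le> M" and c: "c > 0"
    and fin: "modular s (\<lambda>x. f x /\<^sub>R c) < \<infinity>"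
    and sm: "s \<in> borel_measurable lebesgue"
  shows "f \<in> Lvar s"
proof -
  have "modular s f \<le> (\<integral>\<^sup>+ x. ennreal (max 1 c powr M) * ennreal (norm (f x /\<^sub>R c) powr s x) \<partial>lebesgue)"
    unfolding modular_def
  proof (rule nn_integral_mono_AE, use s in eventually_elim)
    case (elim x)
    have "norm (f x) powr s x = c powr s x * norm (f x /\<^sub>R c) powr s x"
      using c by (subst powr_mult[symmetric]) (auto simp: mult.assoc[symmetric])
    also have "c powr s x \<le> max 1 c powr s x" using c elim by (intro powr_mono2) auto
    also have "max 1 c powr s x \<le> max 1 c powr M" using elim by (intro powr_mono) auto
    finally show ?case by (simp add: ennreal_mult'[symmetric] mult_right_mono)
  qed
  also have "\<dots> = ennreal (max 1 c powr M) * modular s (\<lambda>x. f x /\<^sub>R c)"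
    unfolding modular_def using f sm by (intro nn_integral_cmult) measurable
  also have "\<dots> < \<infinity>" using fin by (simp add: ennreal_mult_less_top)
  finally show ?thesis using f by (simp add: Lvar_def)
qed

text \<open>
  The decomposition serves two purposes: at \<open>t = 1\<close> it shows that \<open>f\<close> lies in the sum of the two
  spaces, and at general \<open>t\<close> it bounds the \<open>K\<close>-functional.
\<close>

lemma truncation_decomposition:
  fixes f :: "real^'n \<Rightarrow> 'b::{real_normed_field, second_countable_topology}"
  assumes p[measurable]: "p \<in> borel_measurable lebesgue" and f[measurable]: "f \<in> borel_measurable lebesgue"
    and m: "0 < m" "AE x in lebesgue. m \<le> p x" and M: "AE x in lebesgue. p x \<le> M"
    and \<theta>: "0 < \<theta>" "\<theta> < 1" and B: "B > 0" and t: "t > 0"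
    and D: "D \<ge> 1" "D powr (- ((1 - \<theta>) * m)) = 1 - 2 powr (- \<theta> * m)"
    and weak: "\<And>l. l > 0 \<Longrightarrow> weak_modular p f B l \<le> 1"
  obtains f0 f1 where "f0 + f1 = f" "f0 \<in> Lvar (\<lambda>x. (1 - \<theta>) * p x)" "f1 \<in> Linf"
    "Lvar_norm (\<lambda>x. (1 - \<theta>) * p x) f0 + ennreal t * Linf_norm f1 \<le> ennreal ((2 * D + 1) * B * t powr \<theta>)"
proof -
  define a where "a = B * t powr (\<theta> - 1)"
  have a: "a > 0" using B t by (simp add: a_def)
  define f0 where "f0 x = (if norm (f x) > a then f x else 0)" for x
  define f1 where "f1 x = (if norm (f x) > a then 0 else f x)" for x
  let ?q = "\<lambda>x. (1 - \<theta>) * p x"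
  have [measurable]: "f0 \<in> borel_measurable lebesgue" "f1 \<in> borel_measurable lebesgue"
    unfolding f0_def f1_def by measurable
  have mod: "modular ?q (\<lambda>x. f0 x /\<^sub>R (2 * D * B * t powr \<theta>)) \<le> 1"
    unfolding f0_def a_def by (rule modular_truncation_le_one[OF p f m \<theta> B t D weak])
  have c: "2 * D * B * t powr \<theta> > 0" using D B t by simp
  have "modular ?q (\<lambda>x. f0 x /\<^sub>R (2 * D * B * t powr \<theta>)) < \<infinity>"
    using mod by (rule le_less_trans) simp
  moreover have "AE x in lebesgue. 0 \<le> ?q x \<and> ?q x \<le> (1 - \<theta>) * M"
    using m(2) M by eventually_elim (use m(1) \<theta> in auto)
  ultimately have 0: "f0 \<in> Lvar ?q"
    using c by (intro Lvar_of_modular_scaled[where c = "2 * D * B * t powr \<theta>"]) auto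
  have N1: "Linf_norm f1 \<le> ennreal a"
    using a by (intro Linf_norm_leI) (auto simp: f1_def)
  then have "Linf_norm f1 < \<infinity>" by (rule le_less_trans) simp
  then have 1: "f1 \<in> Linf" by (simp add: Linf_def)
  have "Lvar_norm ?q f0 + ennreal t * Linf_norm f1 \<le> ennreal (2 * D * B * t powr \<theta>) + ennreal t * ennreal a"
    by (intro add_mono mult_left_mono Lvar_norm_leI c mod N1) simp
  also have "t * a = B * t powr \<theta>" using t by (simp add: a_def powr_diff)
  then have "ennreal t * ennreal a = ennreal (B * t powr \<theta>)" using t a by (simp add: ennreal_mult'[symmetric])
  also have "ennreal (2 * D * B * t powr \<theta>) + ennreal (B * t powr \<theta>) = ennreal ((2 * D + 1) * B * t powr \<theta>)"
    using c B by (subst ennreal_plus[symmetric]) (simp_all add: distrib_right)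
  finally have sum: "Lvar_norm ?q f0 + ennreal t * Linf_norm f1 \<le> ennreal ((2 * D + 1) * B * t powr \<theta>)" .
  have "f0 + f1 = f" by (rule ext) (simp add: f0_def f1_def)
  then show ?thesis using 0 1 sum by (rule that[of f0 f1])
qed

lemma interp_norm_le_wLvar_norm:
  fixes f :: "real^'n \<Rightarrow> 'b::{real_normed_field, second_countable_topology}"
  assumes p: "p \<in> borel_measurable lebesgue" "\<And>x. p x > 0" and f: "f \<in> borel_measurable lebesgue"
    and m: "0 < m" "AE x in lebesgue. m \<le> p x" and M: "AE x in lebesgue. p x \<le> M"
    and \<theta>: "0 < \<theta>" "\<theta> < 1"
    and D: "D \<ge> 1" "D powr (- ((1 - \<theta>) * m)) = 1 - 2 powr (- \<theta> * m)"
  shows "interp_norm (Lvar (\<lambda>x. (1 - \<theta>) * p x)) (Lvar_norm (\<lambda>x. (1 - \<theta>) * p x)) Linf Linf_norm \<theta> f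
       \<le> ennreal (2 * D + 1) * wLvar_norm p f"
proof (rule ennreal_le_cmult_of_less)
  let ?q = "\<lambda>x. (1 - \<theta>) * p x"
  fix B :: real assume B: "B > 0" "wLvar_norm p f < ennreal B"
  have weak: "weak_modular p f B l \<le> 1" if "l > 0" for l
    using p B that by (intro weak_modular_le_one_of_wLvar_norm_less) (auto simp: less_imp_le)
  show "interp_norm (Lvar ?q) (Lvar_norm ?q) Linf Linf_norm \<theta> f \<le> ennreal ((2 * D + 1) * B)"
    unfolding interp_norm_def
  proof (rule SUP_least)
    fix t :: real assume "t \<in> {0<..}"
    then have t: "t > 0" by simp
    obtain f0 f1 where f01: "f0 + f1 = f" "f0 \<in> Lvar ?q" "f1 \<in> Linf"
      "Lvar_norm ?q f0 + ennreal t * Linf_norm f1 \<le> ennreal ((2 * D + 1) * B * t powr \<theta>)"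
      by (rule truncation_decomposition[OF p(1) f m M \<theta> B(1) t D]) (erule weak, rule that)
    have "peetre_K (Lvar ?q) (Lvar_norm ?q) Linf Linf_norm t f \<le> Lvar_norm ?q f0 + ennreal t * Linf_norm f1"
      unfolding peetre_K_def by (intro Inf_lower CollectI exI[of _ f0] exI[of _ f1] conjI refl f01(1-3))
    then have "ennreal (t powr (- \<theta>)) * peetre_K (Lvar ?q) (Lvar_norm ?q) Linf Linf_norm t f
        \<le> ennreal (t powr (- \<theta>)) * ennreal ((2 * D + 1) * B * t powr \<theta>)"
      using f01(4) by (intro mult_left_mono) auto
    also have "\<dots> = ennreal ((2 * D + 1) * B)"
      using t B D by (simp add: ennreal_mult'[symmetric] powr_minus)
    finally show "ennreal (t powr (- \<theta>)) * peetre_K (Lvar ?q) (Lvar_norm ?q) Linf Linf_norm t f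
        \<le> ennreal ((2 * D + 1) * B)" .
  qed
qed (use D in simp)


section \<open>The interpolation space is the weak space\<close>

lemma essinf_posE:
  fixes p :: "'a \<Rightarrow> real"
  assumes "0 < essinf M (\<lambda>x. ereal (p x))"
  obtains m where "0 < m" "AE x in M. m \<le> p x"
proof -
  obtain z where z: "0 < z" "AE x in M. z \<le> ereal (p x)"
    using assms unfolding essinf_def less_Sup_iff by blast
  obtain m where m: "0 < ereal m" "ereal m < z" using ereal_dense2[OF z(1)] by auto
  have "AE x in M. m \<le> p x" using z(2)
  proof eventually_elim
    case (elim x)
    then have "ereal m \<le> ereal (p x)" using m(2) by order
    then show ?case by simp
  qed
  then show ?thesis using m that by simp
qed

lemma esssup_finiteE:
  fixes p :: "'a \<Rightarrow> real"
  assumes "esssup N (\<lambda>x. ereal (p x)) < \<infinity>"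
  obtains M where "AE x in N. p x \<le> M"
proof -
  obtain M where M: "esssup N (\<lambda>x. ereal (p x)) < ereal M" using ereal_dense2[OF assms] by auto
  have "AE x in N. ereal (p x) \<le> esssup N (\<lambda>x. ereal (p x))" by (rule esssup_AE)
  then have "AE x in N. p x \<le> M"
  proof eventually_elim
    case (elim x)
    then have "ereal (p x) \<le> ereal M" using M by order
    then show ?case by simp
  qed
  then show ?thesis by (rule that)
qed

theorem theorem5p1:
  fixes p :: "real^'n \<Rightarrow> real" and \<theta> :: real
  assumes "p \<in> borel_measurable lebesgue"
    and "\<And>x. p x > 0"
    and "0 < essinf lebesgue (\<lambda>x. ereal (p x))"
    and "esssup lebesgue (\<lambda>x. ereal (p x)) < \<infinity>"
    and "0 < \<theta>" and "\<theta> < 1"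
  defines "q \<equiv> \<lambda>x. (1 - \<theta>) * p x"
  shows "interp_space (Lvar q) (Lvar_norm q) Linf Linf_norm \<theta> =
           (wLvar p :: (real^'n \<Rightarrow> 'b::{real_normed_field, second_countable_topology}) set)
       \<and> equivalent_on (wLvar p :: (real^'n \<Rightarrow> 'b) set)
           (interp_norm (Lvar q) (Lvar_norm q) Linf Linf_norm \<theta>) (wLvar_norm p)"
proof -
  let ?I = "interp_norm (Lvar q) (Lvar_norm q) Linf Linf_norm \<theta> :: (real^'n \<Rightarrow> 'b) \<Rightarrow> ennreal"
  obtain m where m: "0 < m" "AE x in lebesgue. m \<le> p x" using essinf_posE assms(3) by blast
  obtain M where M: "AE x in lebesgue. p x \<le> M" using esssup_finiteE assms(4) by blast
  define r where "r = 2 powr (- \<theta> * m)"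
  have "2 powr (- \<theta> * m) < 2 powr 0" using assms m by (intro powr_less_mono) auto
  then have r: "0 < r" "r < 1" by (auto simp: r_def)
  \<comment> \<open>The exponent is chosen to solve \<open>D powr (- ((1 - \<theta>) m)) = 1 - r\<close>.\<close>
  define D where "D = (1 - r) powr (- 1 / ((1 - \<theta>) * m))"
  have "(1 - r) powr 0 \<le> D"
    unfolding D_def using r assms m by (intro powr_mono') auto
  then have D1: "D \<ge> 1" using r by simp
  have "D powr (- ((1 - \<theta>) * m)) = 1 - r"
    unfolding D_def powr_powr using assms m r by simp
  then have D2: "D powr (- ((1 - \<theta>) * m)) = 1 - 2 powr (- \<theta> * m)" by (simp add: r_def)
  have weak_le: "wLvar_norm p f \<le> ennreal 2 * ?I f" for f
    unfolding q_def using assms by (intro wLvar_norm_le_interp_norm) auto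
  have interp_le: "?I f \<le> ennreal (2 * D + 1) * wLvar_norm p f" if "f \<in> wLvar p" for f
    unfolding q_def using assms m M D1 D2 that
    by (intro interp_norm_le_wLvar_norm[where m = m and M = M]) (auto simp: wLvar_def)
  have "interp_space (Lvar q) (Lvar_norm q) Linf Linf_norm \<theta> = (wLvar p :: (real^'n \<Rightarrow> 'b) set)"
  proof (intro set_eqI iffI)
    fix f :: "real^'n \<Rightarrow> 'b"
    assume "f \<in> interp_space (Lvar q) (Lvar_norm q) Linf Linf_norm \<theta>"
    then obtain f0 f1 where f: "f0 \<in> Lvar q" "f1 \<in> Linf" "f = f0 + f1" and fin: "?I f < \<infinity>"
      unfolding interp_space_def by blast
    have "(\<lambda>x. f0 x + f1 x) \<in> borel_measurable lebesgue"
      using f by (intro borel_measurable_add) (auto simp: Lvar_def Linf_def)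
    then have "f \<in> borel_measurable lebesgue" by (simp add: f(3) plus_fun_def)
    moreover have "wLvar_norm p f < \<infinity>"
      using fin by (intro le_less_trans[OF weak_le]) (simp add: ennreal_mult_less_top)
    ultimately show "f \<in> wLvar p" by (simp add: wLvar_def)
  next
    fix f :: "real^'n \<Rightarrow> 'b" assume f: "f \<in> wLvar p"
    then have fm: "f \<in> borel_measurable lebesgue" and fin: "wLvar_norm p f < top"
      by (auto simp: wLvar_def)
    have "ennreal (2 * D + 1) * wLvar_norm p f < top" using fin by (simp add: ennreal_mult_less_top)
    then have "?I f < \<infinity>" using interp_le[OF f] by (simp add: le_less_trans)
    moreover obtain B where B: "B > 0" "wLvar_norm p f < ennreal B"
      proof (cases "wLvar_norm p f")
      case (real w)
      then show ?thesis by (intro that[of "w + 1"]) (auto simp: ennreal_less_iff)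
    qed (use fin in simp)
    have "weak_modular p f B l \<le> 1" if "l > 0" for l
      using assms(2) B that by (intro weak_modular_le_one_of_wLvar_norm_less) (auto simp: less_imp_le)
    then obtain f0 f1 where "f0 + f1 = f" "f0 \<in> Lvar q" "f1 \<in> Linf"
      unfolding q_def
      by (rule truncation_decomposition[OF assms(1) fm m M assms(5,6) B(1) zero_less_one D1 D2])
    then have "\<exists>f0\<in>Lvar q. \<exists>f1\<in>Linf. f = f0 + f1" by (intro bexI) auto
    ultimately show "f \<in> interp_space (Lvar q) (Lvar_norm q) Linf Linf_norm \<theta>"
      unfolding interp_space_def by simp
  qed
  moreover have "equivalent_on (wLvar p) ?I (wLvar_norm p)"
    unfolding equivalent_on_def
  proof (intro exI conjI ballI)
    fix f :: "real^'n \<Rightarrow> 'b" assume f: "f \<in> wLvar p"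
    have "ennreal (1 / (2 * D + 1)) * ?I f
        \<le> ennreal (1 / (2 * D + 1)) * (ennreal (2 * D + 1) * wLvar_norm p f)"
      using interp_le[OF f] by (rule mult_left_mono) simp
    also have "\<dots> = wLvar_norm p f"
      using D1 by (simp add: mult.assoc[symmetric] ennreal_mult'[symmetric] del: ennreal_plus)
    finally show "ennreal (1 / (2 * D + 1)) * ?I f \<le> wLvar_norm p f" .
    show "wLvar_norm p f \<le> ennreal 2 * ?I f" by (rule weak_le)
  qed (use D1 in auto)
  ultimately show ?thesis by blast
qed

end
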